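(* Let $D_1,\dots,D_m$ be nonempty closed (possibly nonconvex) subsets of $\mathbb{R}^n$ with $\bigcap_{i=1}^m D_i^\infty=\{0\}$, and let $\{x^t\}$ be a sequence generated by the averaged projection algorithm, i.e., $x^0\in\mathbb{R}^n$ and $$x^{t+1}\in\frac1m\sum_{i=1}^mP_{D_i}(x^t),\qquad t=0,1,2,\dots$$ Then the sequence $\{x^t\}$ is bounded, $\lim_{t\to\infty}\|x^{t+1}-x^t\|=0$, and any cluster point of $\{x^t\}$ is a stationary point of $\Psi+\delta_C$ with $C=\mathbb{R}^n$ and $\Psi(x)=\sum_{i=1}^m\psi(d_{D_i}^2(x))$, $\psi(s)=\frac sm$.
   Context: For a nonempty closed set $D\subseteq\mathbb{R}^n$: $d_D(x)=\inf_{y\in D}\|x-y\|$; $P_D(x)=\{y\in D:\|x-y\|=d_D(x)\}$ is the set of projections; $D^\infty:=\{x:\exists\, x^t\in D,\ \lambda_t\downarrow0\text{ with }\lambda_tx^t\to x\}$ is the horizon cone; $\delta_D$ is the indicator function. For general $C$ and $\psi$, a point $\bar x\in C$ is a stationary point of $\Psi+\delta_C$ if $0\in\sum_{i=1}^m[2\psi_+'(d_{D_i}^2(\bar x))(\bar x-P_{D_i}(\bar x))]+N_C(\bar x)$ (sum of sets), where $\psi'_+$ is the right derivative and $N_C$ the limiting normal cone; for $C=\mathbb{R}^n$ and $\psi(s)=s/m$ this reads $0\in\sum_{i=1}^m\frac2m(\bar x-P_{D_i}(\bar x))$. *)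

theory Defs
  imports "HOL-Analysis.Analysis"
begin

text \<open>Sums of sets below are Minkowski sums (\<open>HOL-Library.Set_Algebras\<close>), and the distance
  function \<open>d\<^sub>D\<close> is \<^const>\<open>infdist\<close>.\<close>

definition proj_set :: "'a::metric_space set \<Rightarrow> 'a \<Rightarrow> 'a set"
  where "proj_set D x = {y \<in> D. dist x y = infdist x D}"

text \<open>The convergence of \<open>l\<close> to \<open>0\<close> from above is not required to be monotone; passing to a
  subsequence shows that requiring it would yield the same cone.\<close>

definition horizon_cone :: "'a::real_normed_vector set \<Rightarrow> 'a set"
  where "horizon_cone D =
    {x. \<exists>(X :: nat \<Rightarrow> 'a) (l :: nat \<Rightarrow> real).
          (\<forall>t. X t \<in> D) \<and> (\<forall>t. 0 < l t) \<and> l \<longlonglongrightarrow> 0 \<and> (\<lambda>t. l t *\<^sub>R X t) \<longlonglongrightarrow> x}"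

text \<open>Regular (Frechet) normals: \<open>v \<bullet> (y - x) \<le> o(norm (y - x))\<close> as \<open>y \<rightarrow> x\<close> within \<open>C\<close>.\<close>

definition regular_normal_cone :: "'a::real_inner set \<Rightarrow> 'a \<Rightarrow> 'a set"
  where "regular_normal_cone C x =
    {v. x \<in> C \<and> (\<forall>e>0. \<forall>\<^sub>F y in at x within C. v \<bullet> (y - x) \<le> e * norm (y - x))}"

definition limiting_normal_cone :: "'a::real_inner set \<Rightarrow> 'a \<Rightarrow> 'a set"
  where "limiting_normal_cone C x =
    {v. x \<in> C \<and> (\<exists>(X :: nat \<Rightarrow> 'a) (V :: nat \<Rightarrow> 'a).
          (\<forall>k. V k \<in> regular_normal_cone C (X k)) \<and> X \<longlonglongrightarrow> x \<and> V \<longlonglongrightarrow> v)}"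

text \<open>The function \<open>\<psi>\<close> lives on the nonnegative reals; its values at negative arguments
  do not matter, since only right derivatives at points \<open>s \<ge> 0\<close> are taken.\<close>

definition right_deriv :: "(real \<Rightarrow> real) \<Rightarrow> real \<Rightarrow> real"
  where "right_deriv \<psi> s = vector_derivative \<psi> (at_right s)"

text \<open>Stationary points of \<open>\<Psi> + \<delta>\<^sub>C\<close>, where \<open>\<Psi> x = (\<Sum>i=1..m. \<psi> ((infdist x (D i))\<^sup>2))\<close> and
  \<open>\<delta>\<^sub>C\<close> is the indicator function of \<open>C\<close>. The notion depends on the representation of
  \<open>\<Psi>\<close> by \<open>\<psi>\<close> and the \<open>D i\<close>, not just on the function \<open>\<Psi>\<close>.\<close>

definition stationary_point ::
  "(real \<Rightarrow> real) \<Rightarrow> nat \<Rightarrow> (nat \<Rightarrow> 'a::real_inner set) \<Rightarrow> 'a set \<Rightarrow> 'a \<Rightarrow> bool"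
  where "stationary_point \<psi> m D C x \<longleftrightarrow>
    x \<in> C \<and>
    0 \<in> (\<Sum>i=1..m. (\<lambda>p. (2 * right_deriv \<psi> ((infdist x (D i))\<^sup>2)) *\<^sub>R (x - p)) ` proj_set (D i) x)
        + limiting_normal_cone C x"

definition averaged_projection_seq ::
  "nat \<Rightarrow> (nat \<Rightarrow> 'a::real_inner set) \<Rightarrow> (nat \<Rightarrow> 'a) \<Rightarrow> bool"
  where "averaged_projection_seq m D x \<longleftrightarrow>
    (\<forall>t. x (Suc t) \<in> (\<lambda>y. (1 / real m) *\<^sub>R y) ` (\<Sum>i=1..m. proj_set (D i) (x t)))"

definition seq_cluster_point :: "(nat \<Rightarrow> 'a::topological_space) \<Rightarrow> 'a \<Rightarrow> bool"
  where "seq_cluster_point x y \<longleftrightarrow> (\<exists>r. strict_mono r \<and> (x \<circ> r) \<longlonglongrightarrow> y)"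

end

(* One averaging step lowers S(x) = sum_i d_{D_i}(x)^2: if x' is the mean of projections
   p_i of x, then S(x') <= sum_i |x' - p_i|^2 = S(x) - m |x - x'|^2. Hence the squared steps
   are summable, and the distances to all D_i stay bounded along the sequence, so a direction
   in which the sequence escapes to infinity would lie in every horizon cone. At a cluster
   point, pass to a further subsequence along which all m projections converge. *)

theory Submission
  imports Defs
begin

text \<open>The parallel axis identity: expanding each \<open>x - p i\<close> around the mean
  \<open>z\<close> leaves cross terms that cancel, because the deviations \<open>z - p i\<close> sum
  to 0.\<close>

lemma sum_dist_mean_squared:
  fixes p :: "'i \<Rightarrow> 'a::real_inner"
  assumes "finite I" "I \<noteq> {}" and z: "z = (1 / real (card I)) *\<^sub>R (\<Sum>i\<in>I. p i)"
  shows "(\<Sum>i\<in>I. (dist z (p i))\<^sup>2) = (\<Sum>i\<in>I. (dist x (p i))\<^sup>2) - real (card I) * (norm (z - x))\<^sup>2"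
proof -
  have sum_p: "(\<Sum>i\<in>I. p i) = real (card I) *\<^sub>R z"
    using assms by simp
  have "(dist x (p i))\<^sup>2 = (dist z (p i))\<^sup>2 + (norm (z - x))\<^sup>2 + 2 * ((x - z) \<bullet> (z - p i))" for i
    using dot_norm[of "x - z" "z - p i"] by (simp add: dist_norm norm_minus_commute)
  then have "(\<Sum>i\<in>I. (dist x (p i))\<^sup>2) = (\<Sum>i\<in>I. (dist z (p i))\<^sup>2) + real (card I) * (norm (z - x))\<^sup>2
      + 2 * ((x - z) \<bullet> (\<Sum>i\<in>I. z - p i))"
    by (simp add: sum.distrib inner_sum_right sum_distrib_left)
  moreover have "(\<Sum>i\<in>I. z - p i) = 0"
    using sum_p by (simp add: sum_subtractf sum_constant_scaleR)
  ultimately show ?thesis by simp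
qed

text \<open>Fixes one choice of projections for all times at once, so that later arguments handle
  vectors \<open>p t i\<close> instead of Minkowski sums.\<close>

lemma averaged_projection_seqE:
  assumes "averaged_projection_seq m D x"
  obtains p where "\<And>t i. i \<in> {1..m} \<Longrightarrow> p t i \<in> proj_set (D i) (x t)"
    and "\<And>t. x (Suc t) = (1 / real m) *\<^sub>R (\<Sum>i=1..m. p t i)"
proof -
  have "\<exists>q. (\<forall>i\<in>{1..m}. q i \<in> proj_set (D i) (x t)) \<and> x (Suc t) = (1 / real m) *\<^sub>R (\<Sum>i=1..m. q i)" for t
    using assms unfolding averaged_projection_seq_def by (auto simp: set_sum_alt)
  then show thesis using that by metis
qed

lemma averaged_projection_descent:
  fixes x z :: "'a::real_inner"
  assumes "m \<ge> 1" and p: "\<And>i. i \<in> {1..m} \<Longrightarrow> p i \<in> proj_set (D i) x"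
    and z: "z = (1 / real m) *\<^sub>R (\<Sum>i=1..m. p i)"
  shows "(\<Sum>i=1..m. (infdist z (D i))\<^sup>2) + real m * (norm (z - x))\<^sup>2 \<le> (\<Sum>i=1..m. (infdist x (D i))\<^sup>2)"
proof -
  \<comment> \<open>Each \<open>p i\<close> lies in \<open>D i\<close> but need not be nearest to
    \<open>z\<close>, hence only an inequality here; at \<open>x\<close> the same points attain the
    distance.\<close>
  have "(\<Sum>i=1..m. (infdist z (D i))\<^sup>2) \<le> (\<Sum>i=1..m. (dist z (p i))\<^sup>2)"
    using p by (intro sum_mono power_mono infdist_le infdist_nonneg) (auto simp: proj_set_def)
  also have "\<dots> = (\<Sum>i=1..m. (dist x (p i))\<^sup>2) - real m * (norm (z - x))\<^sup>2"
    using sum_dist_mean_squared[of "{1..m}" z p x] assms by simp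
  also have "(\<Sum>i=1..m. (dist x (p i))\<^sup>2) = (\<Sum>i=1..m. (infdist x (D i))\<^sup>2)"
    using p by (intro sum.cong) (auto simp: proj_set_def)
  finally show ?thesis by simp
qed

lemma averaged_projection_decseq:
  assumes "m \<ge> 1" "averaged_projection_seq m D x"
  shows "decseq (\<lambda>t. \<Sum>i=1..m. (infdist (x t) (D i))\<^sup>2)" (is "decseq ?S")
    and "(norm (x (Suc t) - x t))\<^sup>2 \<le>
      (\<Sum>i=1..m. (infdist (x t) (D i))\<^sup>2) - (\<Sum>i=1..m. (infdist (x (Suc t)) (D i))\<^sup>2)"
proof -
  obtain p where p: "\<And>t i. i \<in> {1..m} \<Longrightarrow> p t i \<in> proj_set (D i) (x t)"
    and step: "\<And>t. x (Suc t) = (1 / real m) *\<^sub>R (\<Sum>i=1..m. p t i)"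
    using averaged_projection_seqE[OF assms(2)] by blast
  have le: "(norm (x (Suc t) - x t))\<^sup>2 \<le> ?S t - ?S (Suc t)" for t
    \<comment> \<open>The factor \<open>m\<close> of the descent estimate is weakened to 1.\<close>
    using averaged_projection_descent[OF assms(1) p step, of t] assms(1)
      mult_right_mono[of 1 "real m" "(norm (x (Suc t) - x t))\<^sup>2"] by simp
  show "decseq ?S"
    unfolding decseq_Suc_iff
  proof
    fix t show "?S (Suc t) \<le> ?S t"
      using le[of t] zero_le_power2[of "norm (x (Suc t) - x t)"] by linarith
  qed
  show "(norm (x (Suc t) - x t))\<^sup>2 \<le> ?S t - ?S (Suc t)" by (rule le)
qed

text \<open>A single squared distance is at most the whole sum, which never exceeds its initial
  value \<open>S 0\<close>; this gives \<open>K = sqrt (S 0)\<close>.\<close>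

lemma averaged_projection_infdist_bounded:
  assumes "m \<ge> 1" "averaged_projection_seq m D x"
  obtains K where "\<And>t i. i \<in> {1..m} \<Longrightarrow> infdist (x t) (D i) \<le> K"
proof -
  define S where "S t = (\<Sum>i=1..m. (infdist (x t) (D i))\<^sup>2)" for t
  have S_le: "S t \<le> S 0" for t
    using decseqD[OF averaged_projection_decseq(1)[OF assms], of 0 t] by (simp add: S_def)
  have "infdist (x t) (D i) \<le> sqrt (S 0)" if "i \<in> {1..m}" for t i
  proof (rule real_le_rsqrt)
    have "(infdist (x t) (D i))\<^sup>2 \<le> S t"
      unfolding S_def by (rule member_le_sum[OF that]) auto
    with S_le show "(infdist (x t) (D i))\<^sup>2 \<le> S 0" using order_trans by blast
  qed
  then show thesis using that by blast
qed

text \<open>The squared steps are dominated by consecutive differences of \<open>S\<close>, which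
  converges since it decreases and is nonnegative.\<close>

lemma averaged_projection_steps_tendsto_0:
  assumes "m \<ge> 1" "averaged_projection_seq m D x"
  shows "(\<lambda>t. norm (x (Suc t) - x t)) \<longlonglongrightarrow> 0"
proof -
  define S where "S t = (\<Sum>i=1..m. (infdist (x t) (D i))\<^sup>2)" for t
  have "decseq S" and le: "(norm (x (Suc t) - x t))\<^sup>2 \<le> S t - S (Suc t)" for t
    unfolding S_def by (rule averaged_projection_decseq[OF assms])+
  moreover have "0 \<le> S t" for t by (simp add: S_def sum_nonneg)
  ultimately obtain L where L: "S \<longlonglongrightarrow> L" using decseq_convergent by blast
  have "(\<lambda>t. S t - S (Suc t)) \<longlonglongrightarrow> 0"
    using tendsto_diff[OF L LIMSEQ_Suc[OF L]] by simp
  then have "(\<lambda>t. (norm (x (Suc t) - x t))\<^sup>2) \<longlonglongrightarrow> 0"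
    by (rule Lim_null_comparison[rotated]) (use le in \<open>auto intro: always_eventually\<close>)
  then show ?thesis by simp
qed

text \<open>If \<open>x\<close> were unbounded, a limit \<open>v\<close> of normalized iterates
  would be a unit vector. Rescaling shrinks the bounded gap between \<open>x t\<close> and
  \<open>p t i\<close> to 0, so \<open>v\<close> would lie in every horizon cone.\<close>

lemma bounded_of_Inter_horizon_cone:
  fixes x :: "nat \<Rightarrow> 'a::euclidean_space"
  assumes horizon: "(\<Inter>i\<in>I. horizon_cone (D i)) = {0}"
    and p: "\<And>t i. i \<in> I \<Longrightarrow> p t i \<in> D i"
    and dist_p: "\<And>t i. i \<in> I \<Longrightarrow> dist (x t) (p t i) \<le> K"
  shows "bounded (range x)"
proof (rule ccontr)
  assume "\<not> bounded (range x)"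
  then have "\<exists>t. norm (x t) > real (Suc k)" for k
    unfolding bounded_iff by (force simp: not_le)
  \<comment> \<open>The indices \<open>s k\<close> may fail to increase: the horizon cone asks only
    for some sequence of points of \<open>D i\<close>.\<close>
  then obtain s where s: "\<And>k. norm (x (s k)) > real (Suc k)" by metis
  have norm_pos: "norm (x (s k)) > 0" for k using s[of k] by linarith
  define u where "u k = (1 / norm (x (s k))) *\<^sub>R x (s k)" for k
  have "u k \<in> sphere 0 1" for k
    using norm_pos[of k] by (simp add: u_def)
  then obtain v r where v: "v \<in> sphere 0 1" and r: "strict_mono (r :: nat \<Rightarrow> nat)" "(u \<circ> r) \<longlonglongrightarrow> v"
    using compact_sphere[of "0::'a" 1] unfolding compact_def by blast
  define l where "l k = 1 / norm (x (s (r k)))" for k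
  have l_pos: "l k > 0" for k using norm_pos by (simp add: l_def)
  have "l k \<le> 1 / real (Suc k)" for k
  proof -
    \<comment> \<open>A subsequence satisfies \<open>k \<le> r k\<close>, so the growth rate chosen
      for \<open>s\<close> survives along \<open>r\<close>.\<close>
    have "real (Suc k) \<le> real (Suc (r k))" using seq_suble[OF r(1), of k] by simp
    then have "real (Suc k) \<le> norm (x (s (r k)))" using s[of "r k"] by linarith
    then show ?thesis unfolding l_def by (intro divide_left_mono mult_pos_pos norm_pos) auto
  qed
  then have l: "l \<longlonglongrightarrow> 0"
    by (intro Lim_null_comparison[OF always_eventually LIMSEQ_Suc[OF lim_1_over_n]] allI)
      (use l_pos in \<open>simp add: less_imp_le\<close>)
  have "v \<in> horizon_cone (D i)" if i: "i \<in> I" for i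
  proof -
    have "(\<lambda>k. l k *\<^sub>R (p (s (r k)) i - x (s (r k)))) \<longlonglongrightarrow> 0"
    proof (rule Lim_null_comparison)
      show "(\<lambda>k. l k * K) \<longlonglongrightarrow> 0" using tendsto_mult_left_zero[OF l] by simp
      show "\<forall>\<^sub>F k in sequentially. norm (l k *\<^sub>R (p (s (r k)) i - x (s (r k)))) \<le> l k * K"
        using dist_p[OF i] l_pos by (intro always_eventually allI) (simp add: dist_norm norm_minus_commute less_imp_le)
    qed
    from tendsto_add[OF this r(2)]
    have "(\<lambda>k. l k *\<^sub>R p (s (r k)) i) \<longlonglongrightarrow> v"
      by (simp add: u_def l_def o_def algebra_simps)
    then show ?thesis
      unfolding horizon_cone_def mem_Collect_eq using p[OF i] l_pos l
      by (intro exI[of _ "\<lambda>k. p (s (r k)) i"] exI[of _ l]) auto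
  qed
  then have "v \<in> {0}" using horizon by blast
  with v show False by simp
qed

text \<open>Bolzano-Weierstrass repeated over the finite index set, thinning the subsequence once
  per index.\<close>

lemma bounded_family_convergent_subsequence:
  fixes f :: "nat \<Rightarrow> 'i \<Rightarrow> 'a::heine_borel"
  assumes "finite I" "\<And>i. i \<in> I \<Longrightarrow> bounded (range (\<lambda>k. f k i))"
  shows "\<exists>r :: nat \<Rightarrow> nat. strict_mono r \<and> (\<exists>q. \<forall>i\<in>I. (\<lambda>k. f (r k) i) \<longlonglongrightarrow> q i)"
  using assms
proof (induction I)
  case empty
  show ?case using strict_mono_id by auto
next
  case (insert j I)
  then obtain r q where r: "strict_mono (r :: nat \<Rightarrow> nat)" and q: "\<And>i. i \<in> I \<Longrightarrow> (\<lambda>k. f (r k) i) \<longlonglongrightarrow> q i"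
    by auto
  have "bounded (range (\<lambda>k. f (r k) j))"
    by (rule bounded_subset[OF insert.prems[of j]]) auto
  then obtain l s where s: "strict_mono (s :: nat \<Rightarrow> nat)" and l: "((\<lambda>k. f (r k) j) \<circ> s) \<longlonglongrightarrow> l"
    using bounded_imp_convergent_subsequence by blast
  \<comment> \<open>Limits found earlier survive further thinning, and as \<open>j\<close> is not in
    \<open>I\<close> the update leaves them unchanged.\<close>
  have "(\<lambda>k. f ((r \<circ> s) k) i) \<longlonglongrightarrow> (q(j := l)) i" if "i \<in> insert j I" for i
    using that l LIMSEQ_subseq_LIMSEQ[OF q s] insert.hyps by (auto simp: o_def)
  then show ?case using strict_mono_o[OF r s] by blast
qed

text \<open>Closedness keeps the limit in \<open>D\<close>; continuity of \<open>infdist\<close> and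
  of \<open>dist\<close> gives two limits for the same sequence of distances, which must
  agree.\<close>

lemma proj_set_closed_graph:
  assumes "closed D" "\<And>k. q k \<in> proj_set D (y k)" "q \<longlonglongrightarrow> b" "y \<longlonglongrightarrow> a"
  shows "b \<in> proj_set D a"
proof -
  have "b \<in> D" using assms closed_sequentially[of D q b] by (auto simp: proj_set_def)
  moreover have "(\<lambda>k. dist (y k) (q k)) \<longlonglongrightarrow> infdist a D"
    using tendsto_infdist[OF assms(4), of D] assms(2) by (simp add: proj_set_def)
  then have "dist a b = infdist a D"
    using LIMSEQ_unique tendsto_dist[OF assms(4,3)] by blast
  ultimately show ?thesis by (simp add: proj_set_def)
qed

lemma zero_in_limiting_normal_cone: "x \<in> C \<Longrightarrow> 0 \<in> limiting_normal_cone C x"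
  unfolding limiting_normal_cone_def regular_normal_cone_def mem_Collect_eq
  by (intro conjI exI[of _ "\<lambda>_. x"] exI[of _ "\<lambda>_. 0"]) auto

text \<open>The two-sided derivative restricts to the right. For \<open>c = 0\<close> the convention
  for division by zero makes both sides 0.\<close>

lemma right_deriv_divide: "right_deriv (\<lambda>s. s / c) s = 1 / c"
  unfolding right_deriv_def
  by (rule vector_derivative_within)
    (auto simp: has_real_derivative_iff_has_vector_derivative[symmetric] intro: DERIV_cdivide[OF DERIV_ident])

text \<open>The weights \<open>2 / real m\<close> do not depend on \<open>i\<close> and factor out
  of the sum; the normal cone contributes its element 0.\<close>

lemma stationary_point_average:
  assumes "\<And>i. i \<in> {1..m} \<Longrightarrow> q i \<in> proj_set (D i) y" "(\<Sum>i=1..m. y - q i) = 0"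
  shows "stationary_point (\<lambda>s. s / real m) m D UNIV y"
proof -
  let ?g = "\<lambda>i p. (2 * right_deriv (\<lambda>s. s / real m) ((infdist y (D i))\<^sup>2)) *\<^sub>R (y - p)"
  have "(\<Sum>i=1..m. ?g i (q i)) = (2 / real m) *\<^sub>R (\<Sum>i=1..m. y - q i)"
    by (simp only: right_deriv_divide scaleR_sum_right) simp
  then have "0 = (\<Sum>i=1..m. ?g i (q i))" using assms(2) by simp
  moreover have "\<forall>i\<in>{1..m}. ?g i (q i) \<in> ?g i ` proj_set (D i) y"
    using assms(1) by blast
  ultimately have "0 \<in> (\<Sum>i=1..m. ?g i ` proj_set (D i) y)"
    unfolding set_sum_alt[OF finite_atLeastAtMost] by blast
  from set_plus_intro[OF this zero_in_limiting_normal_cone[OF UNIV_I]]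
  show ?thesis by (simp add: stationary_point_def)
qed

theorem corollary4p5:
  fixes m :: nat
    and D :: "nat \<Rightarrow> (real ^ 'n) set"
    and x :: "nat \<Rightarrow> real ^ 'n"
  assumes "m \<ge> 1"
    and "\<And>i. i \<in> {1..m} \<Longrightarrow> D i \<noteq> {} \<and> closed (D i)"
    and "(\<Inter>i\<in>{1..m}. horizon_cone (D i)) = {0}"
    and "averaged_projection_seq m D x"
  shows "bounded (range x) \<and>
    (\<lambda>t. norm (x (Suc t) - x t)) \<longlonglongrightarrow> 0 \<and>
    (\<forall>y. seq_cluster_point x y \<longrightarrow> stationary_point (\<lambda>s. s / real m) m D UNIV y)"
proof (intro conjI allI impI)
  obtain p where p: "\<And>t i. i \<in> {1..m} \<Longrightarrow> p t i \<in> proj_set (D i) (x t)"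
    and step: "\<And>t. x (Suc t) = (1 / real m) *\<^sub>R (\<Sum>i=1..m. p t i)"
    using averaged_projection_seqE[OF assms(4)] by blast
  obtain K where "\<And>t i. i \<in> {1..m} \<Longrightarrow> infdist (x t) (D i) \<le> K"
    using averaged_projection_infdist_bounded[OF assms(1,4)] by blast
  then have dist_p: "dist (x t) (p t i) \<le> K" if "i \<in> {1..m}" for t i
    using p[OF that] that by (simp add: proj_set_def)
  show bdd: "bounded (range x)"
    using p by (intro bounded_of_Inter_horizon_cone[OF assms(3) _ dist_p]) (auto simp: proj_set_def)
  show steps: "(\<lambda>t. norm (x (Suc t) - x t)) \<longlonglongrightarrow> 0"
    using averaged_projection_steps_tendsto_0[OF assms(1,4)] .
  fix y assume "seq_cluster_point x y"
  then obtain r where r: "strict_mono r" "(x \<circ> r) \<longlonglongrightarrow> y"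
    by (auto simp: seq_cluster_point_def)
  have "bounded (range (\<lambda>k. p (r k) i))" if i: "i \<in> {1..m}" for i
  proof -
    \<comment> \<open>The projections stay within \<open>K\<close> of the bounded iterates.\<close>
    obtain B where "\<And>t. norm (x t) \<le> B" using bdd by (auto simp: bounded_iff)
    then have "norm (p (r k) i) \<le> B + K" for k
      using dist_p[OF i, of "r k"] norm_triangle_sub[of "p (r k) i" "x (r k)"]
      by (smt (verit) dist_norm norm_minus_commute)
    then show ?thesis by (auto simp: bounded_iff)
  qed
  \<comment> \<open>One subsequence serves all indices; the limits \<open>q i\<close> will be the
    projections of \<open>y\<close> that witness stationarity.\<close>
  from bounded_family_convergent_subsequence[of _ "\<lambda>k. p (r k)", OF finite_atLeastAtMost this]
  obtain s q where s: "strict_mono (s :: nat \<Rightarrow> nat)"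
    and q: "\<And>i. i \<in> {1..m} \<Longrightarrow> (\<lambda>k. p (r (s k)) i) \<longlonglongrightarrow> q i"
    by blast
  have y: "(\<lambda>k. x (r (s k))) \<longlonglongrightarrow> y"
    using LIMSEQ_subseq_LIMSEQ[OF r(2) s] by (simp add: o_def)
  show "stationary_point (\<lambda>s. s / real m) m D UNIV y"
  proof (rule stationary_point_average)
    show "q i \<in> proj_set (D i) y" if "i \<in> {1..m}" for i
      using proj_set_closed_graph[OF _ p[OF that] q[OF that] y] assms(2)[OF that] by blast
    have "(\<lambda>k. \<Sum>i=1..m. x (r (s k)) - p (r (s k)) i) \<longlonglongrightarrow> (\<Sum>i=1..m. y - q i)"
      by (intro tendsto_sum tendsto_diff y q)
    \<comment> \<open>The stationarity defect at \<open>x t\<close> is exactly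
      \<open>- real m\<close> times the next step, so vanishing steps force it to 0 in the
      limit.\<close>
    moreover have "(\<Sum>i=1..m. x t - p t i) = - real m *\<^sub>R (x (Suc t) - x t)" for t
      using assms(1) by (simp add: step sum_subtractf sum_constant_scaleR algebra_simps del: sum_constant)
    moreover have "(\<lambda>k. - real m *\<^sub>R (x (Suc (r (s k))) - x (r (s k)))) \<longlonglongrightarrow> 0"
    proof -
      have "(\<lambda>t. - real m *\<^sub>R (x (Suc t) - x t)) \<longlonglongrightarrow> - real m *\<^sub>R 0"
        using steps by (intro tendsto_scaleR tendsto_const) (simp add: tendsto_norm_zero_iff)
      from LIMSEQ_subseq_LIMSEQ[OF this strict_mono_o[OF r(1) s]] show ?thesis
        by (simp add: o_def)
    qed
    ultimately show "(\<Sum>i=1..m. y - q i) = 0"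
      using LIMSEQ_unique by force
  qed
qed

end
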